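(* For every finite word $w$ of length $n$, \[\mathrm{Cl}(w)\le \frac{1}{6}n^2+\frac{7}{6}n+1,\] where $\mathrm{Cl}(w)$ denotes the number of distinct closed factors of $w$ (including the empty word and the letters occurring in $w$).
   Context: Words are over an arbitrary finite alphabet. A factor of a word $w$ is a contiguous subword (possibly empty). A border of a finite word $v$ is a proper prefix of $v$ which is also a suffix of $v$. A finite word $v$ is closed if $|v|\le 1$ (so the empty word and the letters are closed), or if $|v|\ge 2$ and the longest border of $v$ is non-empty and occurs in $v$ exactly twice (as a prefix and as a suffix). $\mathrm{Cl}(w)$ is the number of distinct words that are closed and are factors of $w$. *)

theory Defs
  imports Complex_Main "HOL-Library.Sublist"
begin

text \<open>
  Words are lists; the factor relation is \<^const>\<open>sublist\<close> (contiguous, possibly empty).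
\<close>

definition border :: "'a list \<Rightarrow> 'a list \<Rightarrow> bool" where
  "border u v \<longleftrightarrow> strict_prefix u v \<and> suffix u v"

definition longest_border :: "'a list \<Rightarrow> 'a list \<Rightarrow> bool" where
  "longest_border u v \<longleftrightarrow> border u v \<and> (\<forall>u'. border u' v \<longrightarrow> length u' \<le> length u)"

text \<open>
  An occurrence is identified with its starting position, so occurrences may overlap.
\<close>

definition occurrences :: "'a list \<Rightarrow> 'a list \<Rightarrow> nat set" where
  "occurrences u v = {i. \<exists>ps ss. v = ps @ u @ ss \<and> length ps = i}"

text \<open>
  A border is a proper prefix, so its occurrences as a prefix and as a suffix have different
  starting positions; cardinality 2 means that there are no others.
\<close>

definition closed_word :: "'a list \<Rightarrow> bool" where
  "closed_word v \<longleftrightarrow>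
     length v \<le> 1 \<or>
     (\<exists>u. longest_border u v \<and> u \<noteq> [] \<and> card (occurrences u v) = 2)"

definition Cl :: "'a list \<Rightarrow> nat" where
  "Cl w = card {v. closed_word v \<and> sublist v w}"

lemma longest_border_unique:
  assumes "longest_border u v" "longest_border u' v"
  shows "u = u'"
proof -
  have l: "length u = length u'"
    using assms by (auto simp: longest_border_def intro: antisym)
  have "prefix u v" "prefix u' v"
    using assms by (auto simp: longest_border_def border_def)
  with l show ?thesis
    by (metis append_eq_append_conv prefixE)
qed

lemma longest_border_exists:
  assumes "v \<noteq> []"
  shows "\<exists>u. longest_border u v"
proof -
  have "border [] v" using assms by (auto simp: border_def strict_prefix_def)
  moreover have "\<forall>u. border u v \<longrightarrow> length u < Suc (length v)"
    by (auto simp: border_def strict_prefix_def dest: prefix_length_le)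
  ultimately show ?thesis
    unfolding longest_border_def
    using ex_has_greatest_nat[of "\<lambda>u. border u v" "[]" length "Suc (length v)"]
    by (metis less_imp_le)
qed

lemma border_occurrences:
  assumes "border u v"
  shows "{0, length v - length u} \<subseteq> occurrences u v" "length v - length u \<noteq> 0"
proof -
  obtain zs ps where v: "v = u @ zs" "v = ps @ u" and "u \<noteq> v"
    using assms unfolding border_def strict_prefix_def prefix_def suffix_def by blast
  have "0 \<in> occurrences u v"
    unfolding occurrences_def using v(1) by (metis (mono_tags) append_Nil list.size(3) mem_Collect_eq)
  moreover have "length ps = length v - length u"
    unfolding v(2) by simp
  then have "length v - length u \<in> occurrences u v"
    unfolding occurrences_def using v(2) by (metis (mono_tags) append_Nil2 mem_Collect_eq)
  ultimately show "{0, length v - length u} \<subseteq> occurrences u v"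
    by blast
  show "length v - length u \<noteq> 0"
    using v(1) \<open>u \<noteq> v\<close> by auto
qed

lemma finite_closed_factors: "finite {v. closed_word v \<and> sublist v w}"
proof (rule finite_subset)
  show "{v. closed_word v \<and> sublist v w} \<subseteq> {v. set v \<subseteq> set w \<and> length v \<le> length w}"
    by (auto dest: set_mono_sublist sublist_length_le)
qed (simp add: finite_lists_length_le)

end

theory Submission
  imports Defs
begin

text \<open>
  Let \<open>R x\<close> be the longest suffix of \<open>x\<close> that also occurs earlier in \<open>x\<close>. Appending a letter to a word
  creates at most \<open>|R x| - |R (R x)|\<close> new closed factors of length at least two, where \<open>x\<close> is the
  extended word; call this the gain of \<open>x\<close>, and let \<open>P\<close> be the largest gain of a factor of \<open>w\<close> or of its
  reversal. By induction on \<open>|w|\<close> we may assume \<open>|w| \<le> 3P\<close>. Choose a factor \<open>v\<close> of gain \<open>P\<close> and trim it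
  on the left until \<open>R v\<close> is a border. Pairing the prefix of length \<open>i\<close> of \<open>v\<close> with the prefix that ends
  at its first recurrence from position \<open>P\<close> on, the gains along \<open>v\<close> sum to at most
  \<open>min P 1 + \<dots> + min P (|v| - P)\<close>. Every further letter, on either side, costs at most \<open>P\<close>, so with
  \<open>n = |w|\<close> there are at most \<open>Pn - P(3P - 1)/2 \<le> n(n + 1)/6\<close> closed factors of length at least two, and
  at most \<open>n + 1\<close> shorter ones.
\<close>

section \<open>Repeated suffixes\<close>

text \<open>A word is a window of an infinite sequence, so that a word and its factors share one
  indexing. For a list \<open>xs\<close> the sequence is \<open>nth xs\<close>, of which only
  positions below \<open>length xs\<close> matter.\<close>

definition agree :: "(nat \<Rightarrow> 'a) \<Rightarrow> nat \<Rightarrow> nat \<Rightarrow> nat \<Rightarrow> bool" where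
  "agree T s t m \<longleftrightarrow> (\<forall>k<m. T (s + k) = T (t + k))"

definition period :: "(nat \<Rightarrow> 'a) \<Rightarrow> nat \<Rightarrow> nat \<Rightarrow> nat \<Rightarrow> bool" where
  "period T q a e \<longleftrightarrow> (\<forall>k. a \<le> k \<longrightarrow> k + q < e \<longrightarrow> T k = T (k + q))"

text \<open>The earlier copy lies \<open>d\<close> positions back, inside the window from
  \<open>a\<close> to \<open>e\<close>, and may overlap the suffix.\<close>

definition repeats :: "(nat \<Rightarrow> 'a) \<Rightarrow> nat \<Rightarrow> nat \<Rightarrow> nat set" where
  "repeats T a e = {m. \<exists>d>0. a + m + d \<le> e \<and> agree T (e - m - d) (e - m) m}"

text \<open>The length of \<open>R\<close>; the inserted \<open>0\<close> is the default for an
  empty window, where \<open>repeats\<close> is empty.\<close>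

definition lr :: "(nat \<Rightarrow> 'a) \<Rightarrow> nat \<Rightarrow> nat \<Rightarrow> nat" where
  "lr T a e = Max (insert 0 (repeats T a e))"

definition gain :: "(nat \<Rightarrow> 'a) \<Rightarrow> nat \<Rightarrow> nat \<Rightarrow> nat" where
  "gain T a e = lr T a e - lr T (e - lr T a e) e"

lemma agree_suffix:
  assumes "agree T s t m" "j + i \<le> m"
  shows "agree T (s + j) (t + j) i"
  unfolding agree_def
proof (intro allI impI)
  fix k assume "k < i"
  then have "j + k < m" using assms(2) by simp
  then show "T (s + j + k) = T (t + j + k)"
    using assms(1) unfolding agree_def by (metis add.assoc)
qed

lemma agree_mono: "agree T s t m \<Longrightarrow> i \<le> m \<Longrightarrow> agree T s t i"
  by (auto simp: agree_def)

lemma agree_sym: "agree T s t m \<Longrightarrow> agree T t s m"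
  by (auto simp: agree_def)

lemma agree_trans: "agree T s t m \<Longrightarrow> agree T t r m \<Longrightarrow> agree T s r m"
  by (auto simp: agree_def)

lemma finite_repeats: "finite (repeats T a e)"
  by (rule finite_subset[of _ "{..e}"]) (auto simp: repeats_def)

lemma lr_ge:
  assumes "d > 0" "a + m + d \<le> e" "agree T (e - m - d) (e - m) m"
  shows "m \<le> lr T a e"
proof -
  have "m \<in> repeats T a e" using assms by (auto simp: repeats_def)
  then show ?thesis unfolding lr_def using finite_repeats[of T a e] by (intro Max_ge) auto
qed

lemma lr_witness:
  assumes "a < e"
  obtains d where "d > 0" "a + lr T a e + d \<le> e" "agree T (e - lr T a e - d) (e - lr T a e) (lr T a e)"
proof -
  have "0 \<in> repeats T a e"
    using assms by (auto simp: repeats_def agree_def intro!: exI[of _ 1])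
  then have "lr T a e \<in> repeats T a e"
    unfolding lr_def using Max_in[of "repeats T a e"] finite_repeats by (metis empty_iff insert_absorb)
  then show ?thesis
    using that by (auto simp: repeats_def)
qed

lemma lr_empty: "e \<le> a \<Longrightarrow> lr T a e = 0"
proof -
  assume "e \<le> a"
  then have "repeats T a e = {}" by (auto simp: repeats_def)
  then show ?thesis by (simp add: lr_def)
qed

lemma lr_less: "a < e \<Longrightarrow> a + lr T a e < e"
  by (rule lr_witness[of a e T]) auto

lemma lr_le: "lr T a e \<le> e - a"
  using lr_less[of a e T] lr_empty[of e a T] by (cases "a < e") auto

lemma lr_mono:
  assumes "a \<le> b"
  shows "lr T b e \<le> lr T a e"
proof (cases "b < e")
  case True
  then obtain d where "d > 0" "b + lr T b e + d \<le> e" "agree T (e - lr T b e - d) (e - lr T b e) (lr T b e)"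
    by (rule lr_witness)
  then show ?thesis using assms by (intro lr_ge[of d]) auto
qed (simp add: lr_empty)

text \<open>Dropping the last letter from both copies of a repeated suffix leaves a repeated suffix
  of the shorter window.\<close>

lemma lr_Suc: "lr T a (Suc e) \<le> Suc (lr T a e)"
proof (cases "lr T a (Suc e)")
  case (Suc m)
  then have "a < Suc e" using lr_empty[of "Suc e" a T] by (metis not_le nat.distinct(1))
  then obtain d where d: "d > 0" "a + Suc m + d \<le> Suc e" "agree T (Suc e - Suc m - d) (Suc e - Suc m) (Suc m)"
    using lr_witness[of a "Suc e" T] Suc by metis
  have "m \<le> lr T a e"
    using d by (intro lr_ge[of d]) (auto intro: agree_mono)
  then show ?thesis using Suc by simp
qed simp

lemma lr_diff_mono:
  assumes "e \<le> e'"
  shows "e - lr T a e \<le> e' - lr T a e'"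
  using assms
proof (induction e' rule: dec_induct)
  case (step k)
  then show ?case using lr_Suc[of T a k] by linarith
qed simp

text \<open>The same distance \<open>d\<close> serves as a witness, since both copies lie inside the
  window.\<close>

lemma lr_cong_le:
  assumes "\<And>k. k < n \<Longrightarrow> T (a + k) = U (b + k)"
  shows "lr T a (a + n) \<le> lr U b (b + n)"
proof (cases "n = 0")
  case False
  define m where "m = lr T a (a + n)"
  from False obtain d where d: "d > 0" "a + m + d \<le> a + n" "agree T (a + n - m - d) (a + n - m) m"
    unfolding m_def using lr_witness[of a "a + n" T] by auto
  have "agree U (b + n - m - d) (b + n - m) m"
    unfolding agree_def
  proof (intro allI impI)
    fix k assume k: "k < m"
    have i: "b + n - m - d + k = b + (n - m - d + k)" "a + n - m - d + k = a + (n - m - d + k)"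
      "b + n - m + k = b + (n - m + k)" "a + n - m + k = a + (n - m + k)"
      using d(2) by linarith+
    have "U (b + n - m - d + k) = T (a + n - m - d + k)"
      unfolding i using assms[of "n - m - d + k"] d k by simp
    also have "\<dots> = T (a + n - m + k)"
      using d(3) k by (simp add: agree_def)
    also have "\<dots> = U (b + n - m + k)"
      unfolding i using assms[of "n - m + k"] d k by simp
    finally show "U (b + n - m - d + k) = U (b + n - m + k)" .
  qed
  then show ?thesis
    unfolding m_def[symmetric] using d by (intro lr_ge[of d]) auto
qed (simp add: lr_empty)

lemma lr_cong:
  assumes "\<And>k. k < n \<Longrightarrow> T (a + k) = U (b + k)"
  shows "lr T a (a + n) = lr U b (b + n)"
  using lr_cong_le[of n T a U b] lr_cong_le[of n U b T a] assms by (simp add: antisym)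

lemma lr_agree: "agree T a b n \<Longrightarrow> lr T a (a + n) = lr T b (b + n)"
  by (rule lr_cong) (simp add: agree_def)

lemma gain_cong:
  assumes "\<And>k. k < n \<Longrightarrow> T (a + k) = U (b + k)"
  shows "gain T a (a + n) = gain U b (b + n)"
proof -
  define m where "m = lr T a (a + n)"
  have m: "lr U b (b + n) = m" "m \<le> n"
    using lr_cong[of n T a U b] assms lr_le[of T a "a + n"] by (auto simp: m_def)
  have "lr T (a + n - m) (a + n - m + m) = lr U (b + n - m) (b + n - m + m)"
  proof (rule lr_cong)
    fix k assume "k < m"
    moreover have "a + n - m + k = a + (n - m + k)" "b + n - m + k = b + (n - m + k)"
      using m(2) by linarith+
    ultimately show "T (a + n - m + k) = U (b + n - m + k)"
      using assms[of "n - m + k"] m(2) by simp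
  qed
  then show ?thesis using m by (simp add: gain_def m_def[symmetric])
qed

section \<open>Periods and bounds on the gain\<close>

lemma period_mono: "period T q a e \<Longrightarrow> a \<le> b \<Longrightarrow> f \<le> e \<Longrightarrow> period T q b f"
  by (auto simp: period_def)

lemma agree_period:
  assumes "agree T s (s + q) m"
  shows "period T q s (s + q + m)"
  unfolding period_def
proof (intro allI impI)
  fix k assume k: "s \<le> k" "k + q < s + q + m"
  then have "k - s < m" by linarith
  then have "T (s + (k - s)) = T (s + q + (k - s))"
    using assms unfolding agree_def by blast
  moreover have "s + (k - s) = k" "s + q + (k - s) = k + q" using k by linarith+
  ultimately show "T k = T (k + q)" by simp
qed

lemma lr_period:
  assumes "period T q a e" "q > 0"
  shows "e - a - q \<le> lr T a e"
proof (cases "a + q \<le> e")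
  case True
  show ?thesis
  proof (rule lr_ge[of q])
    show "agree T (e - (e - a - q) - q) (e - (e - a - q)) (e - a - q)"
      using assms(1) True by (auto simp: agree_def period_def add_ac)
  qed (use assms True in auto)
qed simp

lemma gain_le_lr: "gain T a e \<le> lr T a e"
  by (simp add: gain_def)

text \<open>An earlier copy at distance \<open>d\<close> gives \<open>R\<close> the period
  \<open>d\<close>, so by \<open>lr_period\<close> all but \<open>d\<close> letters of
  \<open>R\<close> form a repeated suffix of \<open>R\<close>.\<close>

lemma gain_le_dist:
  assumes "d > 0" "a + lr T a e + d \<le> e" "agree T (e - lr T a e - d) (e - lr T a e) (lr T a e)"
  shows "gain T a e \<le> d"
proof -
  let ?m = "lr T a e"
  have "period T d (e - ?m - d) (e - ?m - d + d + ?m)"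
    using assms by (intro agree_period) simp
  then have "period T d (e - ?m) e"
    by (rule period_mono) (use assms in auto)
  then have "e - (e - ?m) - d \<le> lr T (e - ?m) e"
    using assms(1) by (rule lr_period)
  then show ?thesis using assms(2) by (simp add: gain_def)
qed

text \<open>The gain is at most the length of \<open>R\<close> and at most the distance to its
  earlier copy; together these two fit into the window.\<close>

lemma gain_half: "2 * gain T a e \<le> e - a"
proof (cases "a < e")
  case True
  then obtain d where "d > 0" "a + lr T a e + d \<le> e" "agree T (e - lr T a e - d) (e - lr T a e) (lr T a e)"
    by (rule lr_witness)
  with gain_le_dist[of d a T e] gain_le_lr[of T a e] show ?thesis by linarith
qed (simp add: gain_def lr_empty)

text \<open>
  Shifting by both periods shows that the word minus its first \<open>q1\<close> letters has period \<open>q2 - q1\<close>.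
\<close>

lemma gain_two_periods:
  assumes "period T q1 b e" "period T q2 b e" "0 < q1" "q1 < q2" "b + q2 \<le> e" "b \<le> a" "a \<le> e"
  shows "gain T a e + (e - b - lr T b e) \<le> q2"
proof -
  let ?d = "q2 - q1"
  have per: "period T ?d (b + q1) e"
    unfolding period_def
  proof (intro allI impI)
    fix k assume k: "b + q1 \<le> k" "k + ?d < e"
    have "T (k - q1) = T (k - q1 + q1)"
      using assms(1)[unfolded period_def, rule_format, of "k - q1"] k by simp
    then have "T k = T (k - q1)" using k by simp
    moreover have "T (k - q1) = T (k - q1 + q2)"
      using assms(2)[unfolded period_def, rule_format, of "k - q1"] k assms(4) by simp
    moreover have "k - q1 + q2 = k + ?d" using k assms(4) by simp
    ultimately show "T k = T (k + ?d)" by simp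
  qed
  have l1: "e - b - q1 \<le> lr T b e"
    using assms by (intro lr_period) auto
  let ?r = "lr T a e"
  have l2: "?r \<le> lr T b e" using assms by (intro lr_mono)
  have l3: "lr T b e \<le> e - b" by (rule lr_le)
  \<comment> \<open>Either \<open>R\<close> of the window from \<open>a\<close> avoids the first
    \<open>q1\<close> letters and has period \<open>?d\<close>, or it contains everything from
    \<open>b + q1\<close> on and its own repeated suffix is long by monotonicity.\<close>
  show ?thesis
  proof (cases "?r \<le> e - b - q1")
    case True
    have "period T ?d (e - ?r) e"
      by (rule period_mono[OF per]) (use True assms in auto)
    then have "e - (e - ?r) - ?d \<le> lr T (e - ?r) e"
      using assms by (intro lr_period) auto
    then have "gain T a e \<le> ?d" using True by (simp add: gain_def)
    then show ?thesis using l1 assms by linarith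
  next
    case False
    have "e - (b + q1) - ?d \<le> lr T (b + q1) e"
      using per assms by (intro lr_period) auto
    also have "\<dots> \<le> lr T (e - ?r) e"
      using False assms by (intro lr_mono) linarith
    finally have "e - b \<le> lr T (e - ?r) e + q2" using assms(3-5) by linarith
    moreover have "e - b < ?r + q1" using False by linarith
    ultimately show ?thesis using l2 l3 assms(4) unfolding gain_def by linarith
  qed
qed

section \<open>A word with a border of maximal gain\<close>

text \<open>The trimmed word \<open>v\<close>: \<open>border\<close> places the earlier copy of
  \<open>R v\<close> at the very beginning, and \<open>gain_le\<close> concerns prefixes, over which
  the gains are summed.\<close>

locale extremal_border =
  fixes T :: "nat \<Rightarrow> 'a" and n P L :: nat
  assumes L_eq: "L = lr T 0 n"
    and P_eq: "P = gain T 0 n"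
    and P_pos: "P > 0"
    and border: "agree T 0 (n - L) L"
    and gain_le: "\<And>h. h \<le> n \<Longrightarrow> gain T 0 h \<le> P"
    and short: "n \<le> 3 * P"
begin

lemma n_pos: "0 < n"
  using P_pos P_eq by (cases n) (auto simp: gain_def lr_empty)

lemma L_less: "L < n"
  using lr_less[of 0 n T] n_pos L_eq by simp

text \<open>The prefix of length \<open>L\<close> is a copy of \<open>R v\<close>, whose own
  repeated suffix has length \<open>L - P\<close> by definition of the gain.\<close>

lemma lr_L: "lr T 0 L + P = L"
proof -
  have "lr T 0 L = lr T (n - L) n"
    using lr_agree[OF border] L_less by simp
  then show ?thesis
    using P_eq P_pos L_eq unfolding gain_def by simp
qed

lemma P_le_L: "P \<le> L"
  using lr_L by simp

lemma P_le_dist: "P \<le> n - L"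
  unfolding P_eq
  by (rule gain_le_dist) (use border L_less in \<open>auto simp flip: L_eq\<close>)

text \<open>Such a period would give the border a repeated suffix longer than the
  \<open>L - P\<close> of \<open>lr_L\<close>.\<close>

lemma not_period:
  assumes "0 < q" "q < P"
  shows "\<not> period T q 0 L"
proof
  assume "period T q 0 L"
  from lr_period[OF this assms(1)] show False
    using lr_L assms(2) P_le_L by linarith
qed

text \<open>With the threshold \<open>P\<close>, an occurrence of the prefix at a positive position
  before \<open>start i\<close> begins below \<open>P\<close>. It forces a period below
  \<open>P\<close>, on which \<open>not_period\<close> bears.\<close>

definition start :: "nat \<Rightarrow> nat" where
  "start i = (LEAST y. P \<le> y \<and> agree T 0 y i)"

definition row :: "nat \<Rightarrow> nat" where
  "row i = start i + i"

text \<open>The second occurrence of the border starts at \<open>n - L\<close>, which is at least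
  \<open>P\<close>; hence the minimum exists.\<close>

lemma start:
  assumes "i \<le> L"
  shows "P \<le> start i" "agree T 0 (start i) i" "start i \<le> n - L"
proof -
  have *: "P \<le> n - L \<and> agree T 0 (n - L) i"
    using P_le_dist agree_mono[OF border assms] by simp
  show "P \<le> start i" "agree T 0 (start i) i"
    using LeastI[of "\<lambda>y. P \<le> y \<and> agree T 0 y i", OF *] unfolding start_def by auto
  show "start i \<le> n - L"
    unfolding start_def using * by (rule Least_le)
qed

lemma start_least: "P \<le> y \<Longrightarrow> agree T 0 y i \<Longrightarrow> start i \<le> y"
  unfolding start_def by (rule Least_le) simp

lemma row_le: "i \<le> L \<Longrightarrow> row i \<le> n"
  using start(3)[of i] L_less unfolding row_def by linarith

lemma row_ge: "i \<le> L \<Longrightarrow> P + i \<le> row i"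
  using start(1)[of i] unfolding row_def by linarith

text \<open>A recurrence of a longer prefix is also one of a shorter prefix, so \<open>start\<close>
  is monotone. This makes \<open>row\<close> injective up to \<open>L\<close>.\<close>

lemma row_less:
  assumes "i < j" "j \<le> L"
  shows "row i < row j"
proof -
  have "start i \<le> start j"
    using start[of j] assms by (intro start_least) (auto intro: agree_mono)
  then show ?thesis using assms by (simp add: row_def)
qed

section \<open>Longer repeats at the end of a recurrence\<close>

lemma lr_ge_occ:
  assumes "agree T 0 y i" "0 < y"
  shows "i \<le> lr T 0 (y + i)"
  using assms by (intro lr_ge[of y]) auto

lemma lr_occ:
  assumes "agree T 0 y i"
  shows "lr T y (y + i) = lr T 0 i"
  using lr_agree[OF assms] by simp

text \<open>The earlier copy of the longer suffix ends with another occurrence of the prefix, at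
  \<open>z\<close>; the \<open>x\<close> additional letters precede both occurrences.\<close>

lemma longer_repeat:
  assumes "agree T 0 y i" "i < lr T 0 (y + i)"
  obtains z x where "0 < x" "x \<le> z" "z < y" "agree T 0 z i" "x + i = lr T 0 (y + i)"
    "agree T (z - x) (y - x) (x + i)"
proof -
  let ?l = "lr T 0 (y + i)"
  have "0 < y + i" using assms(2) lr_empty[of "y + i" 0 T] by (metis not_less0 not_gr_zero le_refl)
  then obtain d where d: "d > 0" "0 + ?l + d \<le> y + i" "agree T (y + i - ?l - d) (y + i - ?l) ?l"
    by (rule lr_witness)
  define z x where "z = y - d" and "x = ?l - i"
  have e: "y + i - ?l - d = z - x" "y + i - ?l = y - x" "x \<le> z" "z < y" "x + i = ?l" "z - x + x = z" "y - x + x = y" "0 < x"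
    using d assms(2) unfolding z_def x_def by linarith+
  have a: "agree T (z - x) (y - x) (x + i)" using d(3)[unfolded e(1), unfolded e(2)] unfolding e(5) .
  have "agree T z y i" using agree_suffix[OF a, of x i] e by simp
  then have "agree T 0 z i" using assms(1) agree_sym agree_trans by blast
  then show ?thesis using that e a by blast
qed

text \<open>The copy of the prefix ending at \<open>row i\<close> is a suffix of \<open>R\<close>,
  so the repeated suffix of \<open>R\<close> has length at least \<open>lr T 0 i\<close>, hence at
  least \<open>gain T 0 i\<close>.\<close>

lemma gain_row_sum:
  assumes "i \<le> L"
  shows "gain T 0 i + gain T 0 (row i) \<le> lr T 0 (row i)"
proof -
  let ?l = "lr T 0 (row i)"
  have "i \<le> ?l"
    using lr_ge_occ[OF start(2)] start(1)[OF assms] P_pos assms unfolding row_def by simp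
  then have "lr T (row i - i) (row i) \<le> lr T (row i - ?l) (row i)"
    by (intro lr_mono) simp
  then have "lr T 0 i \<le> lr T (row i - ?l) (row i)"
    using lr_occ[OF start(2)[OF assms]] by (simp add: row_def)
  moreover have "lr T (row i - ?l) (row i) \<le> ?l"
    using lr_le[of T "row i - ?l" "row i"] by linarith
  ultimately show ?thesis
    using gain_le_lr[of T 0 i] unfolding gain_def[of T 0 "row i"] by linarith
qed

text \<open>By minimality of \<open>start i\<close>, the earlier occurrence \<open>z\<close> lies
  below \<open>P\<close>. It yields the period \<open>z\<close>, which cannot last up to
  \<open>L\<close>.\<close>

lemma longer_repeat_row:
  assumes "i \<le> L" "i < lr T 0 (row i)"
  obtains z x where "0 < x" "x \<le> z" "z < P" "agree T 0 z i" "x + i = lr T 0 (row i)"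
    "agree T (z - x) (start i - x) (x + i)" "period T z 0 (z + i)" "z + i < L"
proof -
  obtain z x where zx: "0 < x" "x \<le> z" "z < start i" "agree T 0 z i" "x + i = lr T 0 (row i)"
    "agree T (z - x) (start i - x) (x + i)"
    using longer_repeat[OF start(2)[OF assms(1)]] assms(2) unfolding row_def by blast
  have "z < P" using start_least[OF _ zx(4)] zx(3) by (meson not_le)
  moreover have per: "period T z 0 (z + i)"
    using agree_period[of T 0 z i] zx(4) by simp
  moreover have "z + i < L"
    using not_period[of z] period_mono[OF per, of 0 L] zx \<open>z < P\<close> by (meson le_refl less_le_trans not_le)
  ultimately show ?thesis using that zx by blast
qed

text \<open>If \<open>R\<close> at \<open>row i\<close> is longer than \<open>P\<close>, it has two
  periods: \<open>z\<close>, inherited from the prefix, and the distance \<open>D\<close> between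
  its copies. For \<open>D < P\<close> with distinct periods \<open>gain_two_periods\<close>
  applies; the other cases follow by counting letters.\<close>

lemma gain_row_sum_le_P:
  assumes "i \<le> P"
  shows "gain T 0 i + gain T 0 (row i) \<le> P"
proof (cases "lr T 0 (row i) \<le> P")
  case True
  then show ?thesis using gain_row_sum[of i] assms P_le_L by simp
next
  case False
  define y where "y = start i"
  have iL: "i \<le> L" using assms P_le_L by simp
  have "i < lr T 0 (row i)" using False assms by simp
  from longer_repeat_row[OF iL this] obtain z x where zx: "0 < x" "x \<le> z" "z < P" "agree T 0 z i"
    "x + i = lr T 0 (row i)" "agree T (z - x) (y - x) (x + i)" "period T z 0 (z + i)" "z + i < L"
    unfolding y_def by metis
  define l where "l = lr T 0 (row i)"
  have l: "l = x + i" "P < l" using zx False by (auto simp: l_def)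
  have y: "P \<le> y" "agree T 0 y i" "y \<le> n - L" using start[OF iL] by (auto simp: y_def)
  have row: "row i = y + i" by (simp add: row_def y_def)
  define D where "D = y - z"
  have D: "z + D = y" "0 < D" using zx y by (auto simp: D_def)
  \<comment> \<open>The sum of \<open>z + i < L\<close> and \<open>z + D \<le> n - L\<close>,
    combined with \<open>n \<le> 3 * P\<close>.\<close>
  have size: "2 * z + D + i + 1 \<le> 3 * P"
    using zx y D short L_less by linarith
  have b: "row i - l = y - x" "y - x + l = row i" using row l zx y by linarith+
  then have b3: "row i - (y - x) = l" by linarith
  have gain_row: "gain T 0 (row i) = l - lr T (y - x) (row i)"
    using b by (simp add: gain_def l_def)
  \<comment> \<open>The earlier copy of \<open>R\<close> lies inside the first \<open>z + i\<close>
    letters, which have period \<open>z\<close>.\<close>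
  have pz: "period T z (y - x) (row i)"
    unfolding period_def
  proof (intro allI impI)
    fix k assume k: "y - x \<le> k" "k + z < row i"
    have "k - (y - x) < x + i" "k + z - (y - x) < x + i"
      using k b l by linarith+
    then have "T (z - x + (k - (y - x))) = T (y - x + (k - (y - x)))"
      and "T (z - x + (k + z - (y - x))) = T (y - x + (k + z - (y - x)))"
      using zx(6) unfolding agree_def by blast+
    moreover have "T (z - x + (k - (y - x))) = T (z - x + (k - (y - x)) + z)"
      using zx(7) k zx row y unfolding period_def by simp
    moreover have "z - x + (k - (y - x)) + z = z - x + (k + z - (y - x))"
      "y - x + (k - (y - x)) = k" "y - x + (k + z - (y - x)) = k + z"
      using k zx y by linarith+
    ultimately show "T k = T (k + z)" by simp
  qed
  have "z - x + D = y - x" using D zx by linarith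
  then have pD': "period T D (z - x) (row i)"
    using agree_period[of T "z - x" D "x + i"] zx(6) b l by (simp add: add.assoc)
  then have pD: "period T D (y - x) (row i)"
    by (rule period_mono) (use zx y in auto)
  have gz: "gain T 0 (row i) \<le> z"
    using lr_period[OF pz] zx b gain_row by linarith
  have half: "2 * gain T 0 i \<le> i" using gain_half[of T 0 i] by simp
  consider "P \<le> D" | "D < P" "D < z" | "D < P" "z < D" | "D = z" by linarith
  then show ?thesis
  proof cases
    case 1
    \<comment> \<open>Here \<open>2 * z + i < 2 * P\<close>, while the two gains are at most
      \<open>z\<close> and half of \<open>i\<close>.\<close>
    then show ?thesis using gz half size by linarith
  next
    case 2
    have "gain T (row i - i) (row i) + (row i - (y - x) - lr T (y - x) (row i)) \<le> z"
      by (rule gain_two_periods[OF pD pz]) (use 2 D zx b l row in auto)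
    moreover have "gain T (row i - i) (row i) = gain T 0 i"
      using gain_cong[of i T 0 T y] y(2) row by (simp add: agree_def)
    ultimately have "gain T 0 i + gain T 0 (row i) \<le> z" unfolding gain_row b3 by simp
    then show ?thesis using zx(3) by simp
  next
    case 3
    have "gain T (row i - i) (row i) + (row i - (y - x) - lr T (y - x) (row i)) \<le> D"
      by (rule gain_two_periods[OF pz pD]) (use 3 D zx b l row in auto)
    moreover have "gain T (row i - i) (row i) = gain T 0 i"
      using gain_cong[of i T 0 T y] y(2) row by (simp add: agree_def)
    ultimately have "gain T 0 i + gain T 0 (row i) \<le> D" unfolding gain_row b3 by simp
    then show ?thesis using 3 by simp
  next
    case 4
    \<comment> \<open>The two stretches of period \<open>z\<close> overlap enough:
      \<open>P < l\<close> gives \<open>z - x < i\<close>.\<close>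
    have "period T z 0 (row i)"
      unfolding period_def
    proof (intro allI impI)
      fix k assume k: "0 \<le> k" "k + z < row i"
      show "T k = T (k + z)"
      proof (cases "k < i")
        case True
        then show ?thesis using zx(7) by (simp add: period_def)
      next
        case False
        then have "z - x \<le> k" using l zx by linarith
        then show ?thesis using pD' k 4 by (simp add: period_def)
      qed
    qed
    then have "row i < L"
      using not_period[of z] period_mono[of T z 0 "row i" 0 L] zx by (meson le_refl less_le_trans not_le)
    then have "4 * z + i + 1 \<le> 3 * P"
      using 4 D row y short L_less by linarith
    then show ?thesis using gz half assms by linarith
  qed
qed

text \<open>
  Otherwise the prefix of length \<open>f\<close> that first breaks the period \<open>z\<close> would have gain above \<^term>\<open>P\<close>
  at its second occurrence.
\<close>

lemma lr_row:
  assumes "P < i" "i \<le> L"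
  shows "lr T 0 (row i) = i"
proof (rule ccontr)
  assume "lr T 0 (row i) \<noteq> i"
  moreover have "i \<le> lr T 0 (row i)"
    using lr_ge_occ[OF start(2)] start(1)[OF assms(2)] P_pos assms unfolding row_def by simp
  ultimately have "i < lr T 0 (row i)" by simp
  from longer_repeat_row[OF assms(2) this] obtain z where z: "0 < z" "z < P" "period T z 0 (z + i)" "z + i < L"
    by (metis less_le_trans)
  define f where "f = (LEAST f. \<not> period T z 0 f)"
  have nf: "\<not> period T z 0 f" and fL: "f \<le> L"
    using LeastI[of "\<lambda>f. \<not> period T z 0 f" L] Least_le[of "\<lambda>f. \<not> period T z 0 f" L] not_period z
    unfolding f_def by auto
  have before: "period T z 0 g" if "g < f" for g
    using not_less_Least[of g "\<lambda>f. \<not> period T z 0 f"] that unfolding f_def by auto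
  have zif: "z + i < f"
    using nf z(3) period_mono[of T z 0 "z + i" 0 f] by (meson le_refl not_le)
  define y where "y = (LEAST y. 0 < y \<and> agree T 0 y f)"
  have nL: "0 < n - L \<and> agree T 0 (n - L) f"
    using L_less agree_mono[OF border fL] by simp
  have y: "0 < y" "agree T 0 y f"
    using LeastI[of "\<lambda>y. 0 < y \<and> agree T 0 y f", OF nL] unfolding y_def by auto
  have yn: "y \<le> n - L"
    unfolding y_def using nL by (rule Least_le)
  have least: "y \<le> y'" if "0 < y'" "agree T 0 y' f" for y'
    unfolding y_def using that by (intro Least_le) simp
  \<comment> \<open>A longer repeated suffix would yield an occurrence of the prefix at a positive
    position before \<open>y\<close>.\<close>
  have "lr T 0 (y + f) = f"
  proof (rule ccontr)
    assume "lr T 0 (y + f) \<noteq> f"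
    then have "f < lr T 0 (y + f)" using lr_ge_occ[OF y(2) y(1)] by simp
    from longer_repeat[OF y(2) this] obtain z' where "0 < z'" "z' < y" "agree T 0 z' f"
      by (metis less_le_trans)
    then show False using least[of z'] by simp
  qed
  then have g: "gain T 0 (y + f) = f - lr T 0 f"
    using lr_occ[OF y(2)] by (simp add: gain_def)
  \<comment> \<open>Otherwise the last \<open>z + 1\<close> letters recur earlier in the prefix,
    where the period \<open>z\<close> still holds; the equality carries over to the end, so the
    period would not break at \<open>f\<close>.\<close>
  have "lr T 0 f \<le> z"
  proof (rule ccontr)
    assume "\<not> lr T 0 f \<le> z"
    then have big: "z < lr T 0 f" by simp
    obtain d where d: "d > 0" "0 + lr T 0 f + d \<le> f" "agree T (f - lr T 0 f - d) (f - lr T 0 f) (lr T 0 f)"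
      using lr_witness[of 0 f T] zif by auto
    have last: "T (f - d - 1 - j) = T (f - 1 - j)" if "j < lr T 0 f" for j
    proof -
      have "T (f - lr T 0 f - d + (lr T 0 f - 1 - j)) = T (f - lr T 0 f + (lr T 0 f - 1 - j))"
        using d(3)[unfolded agree_def, rule_format, of "lr T 0 f - 1 - j"] that by linarith
      moreover have "f - lr T 0 f - d + (lr T 0 f - 1 - j) = f - d - 1 - j"
        "f - lr T 0 f + (lr T 0 f - 1 - j) = f - 1 - j"
        using d that by linarith+
      ultimately show ?thesis by simp
    qed
    have "T (f - d - 1 - z) = T (f - d - 1 - z + z)"
      using before[of "f - 1"] d big unfolding period_def by simp
    then have brk: "T (f - 1 - z) = T (f - 1)"
      using last[of z] last[of 0] big d by simp
    have "period T z 0 f"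
      unfolding period_def
    proof (intro allI impI)
      fix k assume k: "0 \<le> k" "k + z < f"
      show "T k = T (k + z)"
      proof (cases "k + z < f - 1")
        case True
        then show ?thesis using before[of "f - 1"] k by (simp add: period_def)
      next
        case False
        then have "k = f - 1 - z" "k + z = f - 1" using k by linarith+
        then show ?thesis using brk by simp
      qed
    qed
    then show False using nf by simp
  qed
  then have "P < gain T 0 (y + f)" using g zif assms by linarith
  moreover have "y + f \<le> n" using yn fL L_less by linarith
  ultimately show False using gain_le[of "y + f"] by simp
qed

section \<open>Summing the gains along the word\<close>

lemma gain_row:
  assumes "P < i" "i \<le> L"
  shows "gain T 0 (row i) = i - lr T 0 i"
  using lr_row[OF assms] lr_occ[OF start(2)[OF assms(2)]] unfolding gain_def row_def by simp

text \<open>Gains up to \<open>P\<close> are absorbed by the rows in \<open>E1\<close>. For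
  \<open>h\<close> from \<open>P + 1\<close> to \<open>L\<close>, the excess of
  \<open>lr T 0 h\<close> over \<open>h - P\<close> is exactly the amount by which the gain at
  \<open>row h\<close> falls short of \<open>P\<close>.\<close>

lemma sum_gain_le: "(\<Sum>h=1..n. gain T 0 h) \<le> (\<Sum>h=P+1..n. min P (h - P))"
proof -
  let ?g = "gain T 0" and ?l = "lr T 0"
  define E1 E2 F where "E1 = row ` {1..P}" and "E2 = row ` {P+1..L}" and "F = {P+1..n}"
  have inj: "inj_on row {1..L}"
  proof (rule inj_onI)
    fix i j assume "i \<in> {1..L}" "j \<in> {1..L}" "row i = row j"
    then show "i = j" using row_less[of i j] row_less[of j i] by (cases i j rule: linorder_cases) auto
  qed
  have inj1: "inj_on row {1..P}" and inj2: "inj_on row {P+1..L}"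
    by (rule inj_on_subset[OF inj]; use P_le_L in auto)+
  have disj: "E1 \<inter> E2 = {}"
    unfolding E1_def E2_def using inj_on_image_Int[OF inj, of "{1..P}" "{P+1..L}"] P_le_L by auto
  have "row i \<in> F" if "i \<in> {1..L}" for i
    using row_le[of i] row_ge[of i] that by (auto simp: F_def)
  then have sub: "E1 \<subseteq> F" "E2 \<subseteq> F"
    unfolding E1_def E2_def using P_le_L by auto
  have sub3: "E1 \<subseteq> F - E2" using sub disj by blast
  have fin: "finite E1" "finite E2" "finite F" by (auto simp: E1_def E2_def F_def)
  have LF: "{P+1..L} \<subseteq> F" using L_less by (auto simp: F_def)
  have d: "h - ?l h \<le> h' - ?l h'" if "h \<le> h'" for h h'
    using lr_diff_mono that .
  have lh: "?l h \<le> h" for h using lr_le[of T 0 h] by simp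
  have dL: "L - ?l L = P" using lr_L by linarith
  have "(\<Sum>h=1..n. ?g h) = (\<Sum>h=1..P. ?g h) + (\<Sum>h\<in>F. ?g h)"
    using sum.ub_add_nat[of 1 P ?g "n - P"] P_le_L L_less by (simp add: F_def)
  also have "(\<Sum>h\<in>F. ?g h) = (\<Sum>h\<in>E2. ?g h) + (\<Sum>h\<in>F - E2. ?g h)"
    using sum.subset_diff[OF sub(2) fin(3), of ?g] by simp
  also have "(\<Sum>h\<in>F - E2. ?g h) = (\<Sum>h\<in>E1. ?g h) + (\<Sum>h\<in>F - E2 - E1. ?g h)"
    using sum.subset_diff[OF sub3 finite_Diff[OF fin(3)], of ?g] by simp
  also have "(\<Sum>h\<in>E1. ?g h) = (\<Sum>i=1..P. ?g (row i))"
    unfolding E1_def sum.reindex[OF inj1] comp_def ..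
  finally have "(\<Sum>h=1..n. ?g h) = (\<Sum>i=1..P. ?g i + ?g (row i)) + (\<Sum>h\<in>E2. ?g h) + (\<Sum>h\<in>F - E2 - E1. ?g h)"
    by (simp add: sum.distrib)
  also have "(\<Sum>i=1..P. ?g i + ?g (row i)) \<le> (\<Sum>i=1..P. min P (?l (row i)))"
    using gain_row_sum gain_row_sum_le_P P_le_L by (intro sum_mono) auto
  also have "(\<Sum>i=1..P. min P (?l (row i))) = (\<Sum>h\<in>E1. min P (?l h))"
    unfolding E1_def sum.reindex[OF inj1] comp_def ..
  also have "(\<Sum>h\<in>F - E2 - E1. ?g h) \<le> (\<Sum>h\<in>F - E2 - E1. min P (?l h))"
    using gain_le gain_le_lr by (intro sum_mono) (auto simp: F_def)
  also have "(\<Sum>h\<in>E1. min P (?l h)) + (\<Sum>h\<in>E2. ?g h) + (\<Sum>h\<in>F - E2 - E1. min P (?l h))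
      = (\<Sum>h\<in>E2. ?g h) + (\<Sum>h\<in>F - E2. min P (?l h))"
    using sum.subset_diff[OF sub3 finite_Diff[OF fin(3)], of "\<lambda>h. min P (?l h)"] by simp
  also have "(\<Sum>h\<in>E2. ?g h) = (\<Sum>i=P+1..L. i - ?l i)"
    unfolding E2_def sum.reindex[OF inj2] comp_def by (intro sum.cong refl gain_row) auto
  \<comment> \<open>Subtraction is truncated: the second summand is the excess, and zero if there is
    none.\<close>
  also have "(\<Sum>h\<in>F - E2. min P (?l h)) \<le> (\<Sum>h\<in>F - E2. min P (h - P) + (?l h - (h - P)))"
    by (intro sum_mono) linarith
  also have "\<dots> = (\<Sum>h\<in>F - E2. min P (h - P)) + (\<Sum>h\<in>F - E2. ?l h - (h - P))"
    by (simp add: sum.distrib)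
  also have "(\<Sum>h\<in>F - E2. ?l h - (h - P)) \<le> (\<Sum>h\<in>F. ?l h - (h - P))"
    using fin by (intro sum_mono2) auto
  \<comment> \<open>From \<open>L\<close> on there is no excess, as \<open>h - ?l h\<close> is
    monotone and equals \<open>P\<close> at \<open>L\<close>.\<close>
  also have "(\<Sum>h\<in>F. ?l h - (h - P)) = (\<Sum>h=P+1..L. ?l h - (h - P))"
  proof (rule sum.mono_neutral_right[OF fin(3) LF], rule ballI)
    fix h assume "h \<in> F - {P+1..L}"
    then have "L \<le> h" by (auto simp: F_def)
    then show "?l h - (h - P) = 0" using d[of L h] dL lh[of h] by linarith
  qed
  finally have "(\<Sum>h=1..n. ?g h) \<le>
      (\<Sum>i=P+1..L. i - ?l i) + (\<Sum>h=P+1..L. ?l h - (h - P)) + (\<Sum>h\<in>F - E2. min P (h - P))"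
    by linarith
  also have "(\<Sum>i=P+1..L. i - ?l i) + (\<Sum>h=P+1..L. ?l h - (h - P)) = (\<Sum>i=P+1..L. P)"
    unfolding sum.distrib[symmetric]
  proof (rule sum.cong[OF refl])
    fix i assume "i \<in> {P+1..L}"
    then show "i - ?l i + (?l i - (i - P)) = P" using d[of i L] dL lh[of i] by auto
  qed
  also have "(\<Sum>i=P+1..L. P) = (\<Sum>h\<in>E2. min P (h - P))"
    unfolding E2_def sum.reindex[OF inj2] comp_def
  proof (rule sum.cong[OF refl])
    fix i assume "i \<in> {P+1..L}"
    then show "P = min P (row i - P)" using row_ge[of i] by auto
  qed
  also have "\<dots> + (\<Sum>h\<in>F - E2. min P (h - P)) = (\<Sum>h\<in>F. min P (h - P))"
    using sum.subset_diff[OF sub(2) fin(3), of "\<lambda>h. min P (h - P)"] by simp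
  finally show ?thesis by (simp add: F_def)
qed

end

section \<open>Counting closed factors\<close>

definition closed_factors :: "'a list \<Rightarrow> 'a list set" where
  "closed_factors xs = {v. closed_word v \<and> 2 \<le> length v \<and> sublist v xs}"

definition last_gain :: "'a list \<Rightarrow> nat" where
  "last_gain xs = gain (nth xs) 0 (length xs)"

lemma closed_factors_Nil [simp]: "closed_factors [] = {}"
  by (auto simp: closed_factors_def)

lemma finite_closed_factors2: "finite (closed_factors xs)"
  by (rule finite_subset[OF _ finite_closed_factors[of xs]]) (auto simp: closed_factors_def)

lemma finite_sublists: "finite {z. sublist z w}"
proof (rule finite_subset)
  show "{z. sublist z w} \<subseteq> {z. set z \<subseteq> set w \<and> length z \<le> length w}"
    by (auto dest: set_mono_sublist sublist_length_le)
qed (simp add: finite_lists_length_le)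

text \<open>The prefix and the suffix use up both occurrences of the longest border; one strictly
  between them would be a third.\<close>

lemma closed_word_return:
  assumes "closed_word v" "2 \<le> length v"
  obtains m where "0 < m" "m < length v" "agree (nth v) 0 (length v - m) m"
    "\<And>s. 0 < s \<Longrightarrow> s < length v - m \<Longrightarrow> \<not> agree (nth v) 0 s m"
proof -
  obtain u where u: "longest_border u v" "u \<noteq> []" "card (occurrences u v) = 2"
    using assms by (auto simp: closed_word_def)
  have b: "border u v" using u(1) by (simp add: longest_border_def)
  obtain zs ps where v: "v = u @ zs" "v = ps @ u" "u \<noteq> v"
    using b unfolding border_def strict_prefix_def prefix_def suffix_def by blast
  define m where "m = length u"
  have m: "0 < m" "m < length v" using u(2) v(1,3) by (auto simp: m_def)
  have u1: "v ! k = u ! k" if "k < m" for k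
    using v(1) that by (simp add: m_def nth_append)
  have u2: "v ! (length v - m + k) = u ! k" if "k < m" for k
    using v(2) that by (simp add: m_def nth_append)
  have "agree (nth v) 0 (length v - m) m"
    using u1 u2 by (simp add: agree_def)
  moreover have "\<not> agree (nth v) 0 s m" if s: "0 < s" "s < length v - m" for s
  proof
    assume a: "agree (nth v) 0 s m"
    have "take m (drop s v) = u"
      using a s u1 by (intro nth_equalityI) (auto simp: agree_def m_def)
    then have "v = take s v @ u @ drop m (drop s v)"
      by (metis append_take_drop_id)
    moreover have "length (take s v) = s" using s by simp
    ultimately have "s \<in> occurrences u v"
      unfolding occurrences_def by blast
    then have "{0, length v - m, s} \<subseteq> occurrences u v"
      using border_occurrences(1)[OF b] by (simp add: m_def)
    moreover have "card {0, length v - m, s} = 3" using s m by simp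
    moreover have "finite (occurrences u v)" using u(3) by (intro card_ge_0_finite) simp
    ultimately show False using u(3) card_mono[of "occurrences u v" "{0, length v - m, s}"] by simp
  qed
  ultimately show ?thesis using that m by blast
qed

text \<open>
  A closed factor that is new at the last letter is determined by the length \<open>m\<close> of its border; it is
  new only if that border does not already recur inside the longest repeated suffix.
\<close>

lemma card_closed_factors_snoc:
  "card (closed_factors (ys @ [x])) \<le> card (closed_factors ys) + last_gain (ys @ [x])"
proof -
  define xs where "xs = ys @ [x]"
  define T N where "T = nth xs" and "N = length xs"
  define L where "L = lr T 0 N"
  define J where "J = lr T (N - L) N"
  \<comment> \<open>The distance from the suffix of length \<open>m\<close> back to its previous
    occurrence; a new closed factor with border length \<open>m\<close> has length
    \<open>m + ret m\<close>.\<close>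
  define ret where "ret m = (LEAST d. 0 < d \<and> agree T (N - m - d) (N - m) m)" for m
  have new: "closed_factors xs - closed_factors ys \<subseteq> (\<lambda>m. drop (N - (m + ret m)) xs) ` {J<..L}"
  proof
    fix v assume v: "v \<in> closed_factors xs - closed_factors ys"
    then have "sublist v (ys @ [x])" "\<not> sublist v ys"
      by (auto simp: closed_factors_def xs_def)
    then have "suffix v xs" using sublist_snoc[of v ys x] by (simp add: xs_def)
    define l where "l = length v"
    have l: "l \<le> N" "v = drop (N - l) xs"
      using \<open>suffix v xs\<close> by (auto simp: suffix_def l_def N_def)
    have nth_v: "v ! k = T (N - l + k)" if "k < l" for k
      using l that by (simp add: T_def N_def)
    obtain m where m: "0 < m" "m < l" "agree (nth v) 0 (l - m) m"
      and mid: "\<And>s. 0 < s \<Longrightarrow> s < l - m \<Longrightarrow> \<not> agree (nth v) 0 s m"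
      using closed_word_return[of v] v unfolding l_def closed_factors_def by auto
    have occ: "agree (nth v) 0 s m \<longleftrightarrow> agree T (N - l) (N - l + s) m" if "s \<le> l - m" for s
      using nth_v m(2) that by (auto simp: agree_def add.assoc)
    have first: "agree T (N - l) (N - m) m"
      using occ[of "l - m"] m l by simp
    have ret_m: "ret m = l - m"
      unfolding ret_def
    proof (rule Least_equality)
      show "0 < l - m \<and> agree T (N - m - (l - m)) (N - m) m"
        using m l first by simp
    next
      fix d assume d: "0 < d \<and> agree T (N - m - d) (N - m) m"
      show "l - m \<le> d"
      proof (rule ccontr)
        assume "\<not> l - m \<le> d"
        then have s: "0 < l - m - d" "l - m - d < l - m" "N - l + (l - m - d) = N - m - d"
          using d m l by linarith+
        have "agree T (N - l) (N - m - d) m"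
          using first d agree_sym agree_trans by blast
        then have "agree (nth v) 0 (l - m - d) m"
          using occ[of "l - m - d"] s by simp
        then show False using mid s by blast
      qed
    qed
    have "m \<le> L"
      unfolding L_def using m l first by (intro lr_ge[of "l - m"]) auto
    \<comment> \<open>If \<open>m \<le> J\<close>, the border recurs within \<open>R\<close>, so
      \<open>v\<close> is a suffix of \<open>R\<close>, and the earlier copy of \<open>R\<close>
      contains \<open>v\<close> before the last letter.\<close>
    moreover have "J < m"
    proof (rule ccontr)
      assume "\<not> J < m"
      then have "m \<le> J" by simp
      have "N - L < N" "0 < N" using m l \<open>m \<le> L\<close> by auto
      then obtain d where d: "d > 0" "N - L + J + d \<le> N" "agree T (N - J - d) (N - J) J"
        using lr_witness[of "N - L" N T] unfolding J_def by blast
      have e: "N - J - d + (J - m) = N - m - d" "N - J + (J - m) = N - m"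
        using d \<open>m \<le> J\<close> by linarith+
      have "agree T (N - m - d) (N - m) m"
        using agree_suffix[OF d(3), of "J - m" m] \<open>m \<le> J\<close> unfolding e by simp
      then have "ret m \<le> d"
        unfolding ret_def using d(1) by (intro Least_le) simp
      then have lL: "l \<le> L" using ret_m d(2) \<open>m \<le> J\<close> by linarith
      obtain c where c: "c > 0" "0 + L + c \<le> N" "agree T (N - L - c) (N - L) L"
        using lr_witness[of 0 N T] \<open>0 < N\<close> unfolding L_def by blast
      have e': "N - L - c + (L - l) = N - l - c" "N - L + (L - l) = N - l"
        using c lL by linarith+
      have a: "agree T (N - l - c) (N - l) l"
        using agree_suffix[OF c(3), of "L - l" l] lL unfolding e' by simp
      have "v = take l (drop (N - l - c) ys)"
      proof (rule nth_equalityI)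
        show "length v = length (take l (drop (N - l - c) ys))"
          using c lL by (simp add: l_def[symmetric] N_def xs_def)
      next
        fix k assume "k < length v"
        then have k: "k < l" by (simp add: l_def)
        then have "N - l - c + k < length ys"
          using c lL by (simp add: N_def xs_def)
        moreover have "v ! k = T (N - l - c + k)"
          using nth_v[OF k] a k by (simp add: agree_def)
        ultimately show "v ! k = take l (drop (N - l - c) ys) ! k"
          using k by (simp add: T_def xs_def nth_append)
      qed
      then have "sublist v ys"
        by (metis sublist_drop sublist_take sublist_order.order_trans)
      then show False using \<open>\<not> sublist v ys\<close> by simp
    qed
    moreover have "v = drop (N - (m + ret m)) xs" using l m ret_m by simp
    ultimately show "v \<in> (\<lambda>m. drop (N - (m + ret m)) xs) ` {J<..L}" by auto
  qed
  have "card (closed_factors xs) \<le> card (closed_factors ys) + card (closed_factors xs - closed_factors ys)"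
    using card_Un_le[of "closed_factors ys" "closed_factors xs - closed_factors ys"]
      card_mono[of "closed_factors ys \<union> (closed_factors xs - closed_factors ys)" "closed_factors xs"]
      finite_closed_factors2[of xs] finite_closed_factors2[of ys] by fastforce
  also have "card (closed_factors xs - closed_factors ys) \<le> card {J<..L}"
    using card_mono[OF _ new] card_image_le[of "{J<..L}" "\<lambda>m. drop (N - (m + ret m)) xs"] by fastforce
  also have "card {J<..L} = last_gain xs"
    by (simp add: last_gain_def gain_def J_def L_def T_def N_def)
  finally show ?thesis by (simp add: xs_def)
qed

lemma last_gain_take:
  assumes "h \<le> length xs"
  shows "last_gain (take h xs) = gain (nth xs) 0 h"
  unfolding last_gain_def using assms gain_cong[of h "nth (take h xs)" 0 "nth xs" 0] by simp

lemma card_closed_factors_le: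
  fixes xs :: "'a list"
  shows "card (closed_factors xs) \<le> (\<Sum>h=1..length xs. gain (nth xs) 0 h)"
proof (induction xs rule: rev_induct)
  case Nil
  show ?case by simp
next
  case (snoc x ys)
  have "(\<Sum>h=1..length ys. gain (nth ys) 0 h) = (\<Sum>h=1..length ys. gain (nth (ys @ [x])) 0 h)"
  proof (rule sum.cong[OF refl])
    fix h assume "h \<in> {1..length ys}"
    then show "gain (nth ys) 0 h = gain (nth (ys @ [x])) 0 h"
      using gain_cong[of h "nth ys" 0 "nth (ys @ [x])" 0] by (simp add: nth_append)
  qed
  then show ?case
    using snoc card_closed_factors_snoc[of ys x] by (simp add: last_gain_def)
qed

section \<open>Invariance under reversal\<close>

lemma border_rev: "border (rev u) (rev v) \<longleftrightarrow> border u v"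
  by (auto simp: border_def strict_prefix_def suffix_to_prefix)

lemma occurrences_rev:
  "occurrences (rev u) (rev v) = (\<lambda>i. length v - length u - i) ` occurrences u v"
proof -
  have sub: "(\<lambda>i. length v - length u - i) ` occurrences u v \<subseteq> occurrences (rev u) (rev v)"
    for u v :: "'a list"
  proof (clarsimp simp: occurrences_def)
    fix ps ss
    show "\<exists>ps'. (\<exists>ss'. rev ss @ rev u @ rev ps = ps' @ rev u @ ss') \<and> length ps' = length ss"
      by (intro exI[of _ "rev ss"]) auto
  qed
  \<comment> \<open>The converse is the inclusion \<open>sub\<close> for the reversed words.\<close>
  have "i \<in> (\<lambda>i. length v - length u - i) ` occurrences u v" if "i \<in> occurrences (rev u) (rev v)" for i
  proof -
    have "length v - length u - i \<in> occurrences u v"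
      using sub[of "rev v" "rev u"] that by auto
    moreover have "i = length v - length u - (length v - length u - i)"
      using that by (auto simp: occurrences_def dest!: arg_cong[of "rev v" _ length])
    ultimately show ?thesis by blast
  qed
  then show ?thesis using sub[of v u] by blast
qed

lemma closed_word_rev: "closed_word v \<Longrightarrow> closed_word (rev v)"
proof -
  assume c: "closed_word v"
  show ?thesis
  proof (cases "length v \<le> 1")
    case False
    then obtain u where u: "longest_border u v" "u \<noteq> []" "card (occurrences u v) = 2"
      using c by (auto simp: closed_word_def)
    have "longest_border (rev u) (rev v)"
      unfolding longest_border_def
    proof (intro conjI allI impI)
      show "border (rev u) (rev v)" using u(1) by (simp add: border_rev longest_border_def)
      fix u' assume "border u' (rev v)"
      then have "border (rev u') v" using border_rev[of "rev u'" v] by simp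
      then show "length u' \<le> length (rev u)" using u(1) by (fastforce simp: longest_border_def)
    qed
    \<comment> \<open>This bound makes the truncated reflection of positions injective.\<close>
    moreover have "i \<le> length v - length u" if "i \<in> occurrences u v" for i
      using that by (auto simp: occurrences_def)
    then have "inj_on (\<lambda>i. length v - length u - i) (occurrences u v)"
      by (intro inj_onI) (metis diff_diff_cancel)
    then have "card (occurrences (rev u) (rev v)) = 2"
      using u(3) by (simp add: occurrences_rev card_image)
    ultimately show ?thesis using u(2) unfolding closed_word_def by (metis rev_is_Nil_conv)
  qed (simp add: closed_word_def)
qed

lemma card_closed_factors_rev: "card (closed_factors (rev xs)) = card (closed_factors xs)"
proof -
  have "closed_factors (rev xs) = rev ` closed_factors xs"
  proof (intro equalityI subsetI)
    fix v assume "v \<in> closed_factors (rev xs)"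
    then have "rev v \<in> closed_factors xs"
      using closed_word_rev[of v] sublist_rev[of "rev v" xs] by (simp add: closed_factors_def)
    then show "v \<in> rev ` closed_factors xs" by (metis image_eqI rev_rev_ident)
  next
    fix v assume "v \<in> rev ` closed_factors xs"
    then show "v \<in> closed_factors (rev xs)"
      using closed_word_rev by (auto simp: closed_factors_def)
  qed
  then show ?thesis by (simp add: card_image)
qed

text \<open>Letters on the right are appended one by one. Letters on the left are appended to the
  reversal, which has the same count; hence the hypothesis on its factors.\<close>

lemma card_closed_factors_extend:
  fixes ps v ss :: "'a list"
  assumes right: "\<And>z. sublist z (ps @ v @ ss) \<Longrightarrow> last_gain z \<le> P"
    and left: "\<And>z. sublist z (rev (ps @ v @ ss)) \<Longrightarrow> last_gain z \<le> P"
  shows "card (closed_factors (ps @ v @ ss)) \<le> card (closed_factors v) + P * (length ps + length ss)"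
  using assms
proof (induction ps)
  case Nil
  then show ?case
  proof (induction ss rule: rev_induct)
    case (snoc x ss)
    have s: "sublist z ([] @ v @ ss) \<Longrightarrow> sublist z ([] @ v @ ss @ [x])"
      "sublist z (rev ([] @ v @ ss)) \<Longrightarrow> sublist z (rev ([] @ v @ ss @ [x]))" for z
      by (auto simp: sublist_Cons_right sublist_def) (metis append.assoc append_Cons append_Nil)+
    have "card (closed_factors ([] @ v @ ss)) \<le> card (closed_factors v) + P * (length ([] :: 'a list) + length ss)"
      using snoc.prems s by (intro snoc.IH) blast+
    moreover have "last_gain ((v @ ss) @ [x]) \<le> P" using snoc.prems(1)[of "(v @ ss) @ [x]"] by simp
    ultimately show ?case using card_closed_factors_snoc[of "v @ ss" x] by simp
  qed simp
next
  case (Cons x ps)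
  let ?w = "ps @ v @ ss"
  have s: "sublist z ?w \<Longrightarrow> sublist z ((x # ps) @ v @ ss)"
    "sublist z (rev ?w) \<Longrightarrow> sublist z (rev ((x # ps) @ v @ ss))" for z
    by (auto simp: sublist_Cons_right sublist_def) (metis append.assoc append_Cons append_Nil)+
  have "card (closed_factors ?w) \<le> card (closed_factors v) + P * (length ps + length ss)"
    using Cons.prems s by (intro Cons.IH) blast+
  moreover have "card (closed_factors (x # ?w)) = card (closed_factors (rev ?w @ [x]))"
    using card_closed_factors_rev[of "x # ?w"] by simp
  moreover have "last_gain (rev ?w @ [x]) \<le> P" using Cons.prems(2)[of "rev ?w @ [x]"] by simp
  ultimately show ?case using card_closed_factors_snoc[of "rev ?w" x] card_closed_factors_rev[of ?w] by simp
qed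

text \<open>The sum is \<open>P * n - P * (3 * P - 1) / 2\<close>, doubled and rearranged to avoid
  subtraction. Beyond \<open>2 * P\<close> every new term is \<open>P\<close>.\<close>

lemma sum_min:
  fixes P n :: nat
  assumes "2 * P \<le> n"
  shows "2 * (\<Sum>h=P+1..n. min P (h - P)) + 3 * P * P = 2 * P * n + P"
  using assms
proof (induction n rule: dec_induct)
  case base
  have "(\<Sum>h=P+1..2*P. min P (h - P)) = (\<Sum>h=1..P. min P (h + P - P))"
    using sum.shift_bounds_cl_nat_ivl[of "\<lambda>h. min P (h - P)" 1 P P] by (simp add: mult_2)
  also have "\<dots> = (\<Sum>h=1..P. h)" by (intro sum.cong) auto
  finally have "2 * (\<Sum>h=P+1..2*P. min P (h - P)) = 2 * (\<Sum>h=1..P. h)" by simp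
  also have "\<dots> = P * (P + 1)" by (induction P) auto
  finally show ?case by (simp add: algebra_simps)
next
  case (step m)
  then have "(\<Sum>h=P+1..Suc m. min P (h - P)) = (\<Sum>h=P+1..m. min P (h - P)) + P"
    by (simp add: min_def)
  then show ?case using step.IH by (simp add: algebra_simps)
qed

text \<open>Cutting off the letters before the earlier copy of \<open>R\<close> makes
  \<open>R\<close> a border and changes neither \<open>R\<close> nor the gain, so
  \<open>extremal_border\<close> applies.\<close>

lemma card_closed_factors_base:
  assumes "0 < last_gain z" "length z \<le> 3 * last_gain z"
    and le: "\<And>y. sublist y z \<Longrightarrow> last_gain y \<le> last_gain z"
  obtains v where "sublist v z" "2 * last_gain z \<le> length v"
    "card (closed_factors v) \<le> (\<Sum>h=last_gain z+1..length v. min (last_gain z) (h - last_gain z))"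
proof -
  define T N P L where "T = nth z" and "N = length z" and "P = last_gain z" and "L = lr T 0 N"
  have P: "P = L - lr T (N - L) N"
    unfolding P_def last_gain_def gain_def L_def T_def N_def ..
  have "0 < N" using assms(1) by (auto simp: N_def last_gain_def gain_def lr_empty)
  then obtain d where d: "d > 0" "0 + L + d \<le> N" "agree T (N - L - d) (N - L) L"
    using lr_witness[of 0 N T] unfolding L_def by blast
  define q n where "q = N - L - d" and "n = N - q"
  define v where "v = drop q z"
  have len: "length v = n" "n = L + d" "q + n = N" "q \<le> N" using d by (auto simp: v_def n_def N_def q_def)
  have nth_v: "v ! k = T (q + k)" for k using len by (simp add: v_def T_def N_def)
  have "L \<le> lr T q N" using d by (intro lr_ge[of d]) (auto simp: q_def)
  moreover have "lr T q N \<le> L" unfolding L_def by (rule lr_mono) simp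
  ultimately have lr_q: "lr T q N = L" by simp
  have "extremal_border (nth v) n P L"
  proof
    show "L = lr (nth v) 0 n"
      using lr_cong[of n "nth v" 0 T q] nth_v lr_q len by simp
    show "P = gain (nth v) 0 n"
      using gain_cong[of n "nth v" 0 T q] nth_v lr_q len P by (simp add: gain_def)
    show "P > 0" using assms by (simp add: P_def)
    show "agree (nth v) 0 (n - L) L"
      using d(3) len by (auto simp: agree_def nth_v q_def)
    show "n \<le> 3 * P" using assms(2) by (simp add: n_def N_def P_def)
    fix h assume "h \<le> n"
    have "sublist (take h v) z"
      unfolding v_def by (metis sublist_drop sublist_take sublist_order.order_trans)
    then show "gain (nth v) 0 h \<le> P"
      using le[of "take h v"] last_gain_take[of h v] \<open>h \<le> n\<close> len(1) by (simp add: P_def)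
  qed
  then interpret extremal_border "nth v" n P L .
  have "2 * P \<le> length v" using P_le_L P_le_dist len by simp
  moreover have "card (closed_factors v) \<le> (\<Sum>h=P+1..length v. min P (h - P))"
    using card_closed_factors_le[of v] sum_gain_le len by simp
  ultimately show ?thesis using that[of v] by (simp add: P_def v_def)
qed

text \<open>The product of the consecutive integers \<open>n - 3 * p\<close> and
  \<open>n - 3 * p + 1\<close> is never negative.\<close>

lemma quadratic_bound:
  fixes c p n :: int
  assumes "2 * c + 3 * p * p \<le> 2 * p * n + p"
  shows "6 * c \<le> n * (n + 1)"
proof -
  have "0 \<le> (n - 3 * p) * (n - 3 * p + 1)"
    unfolding zero_le_mult_iff by linarith
  also have "\<dots> = n * (n + 1) + 3 * (3 * p * p) - 3 * (2 * p * n + p)"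
    by (simp add: algebra_simps)
  finally have "0 \<le> n * (n + 1) + 3 * (3 * p * p) - 3 * (2 * p * n + p)" .
  moreover have "6 * c \<le> z" if "0 \<le> z + 3 * x - 3 * y" "2 * c + x \<le> y" for x y z
    using that by linarith
  ultimately show ?thesis using assms by blast
qed

lemma card_closed_factors_bound: "6 * card (closed_factors w) \<le> length w * (length w + 1)"
proof (induction "length w" arbitrary: w rule: less_induct)
  case less
  define N where "N = length w"
  define Z where "Z = {z. sublist z w} \<union> {z. sublist z (rev w)}"
  define P where "P = Max (last_gain ` Z)"
  have fin: "finite Z" and ne: "w \<in> Z"
    by (auto simp: Z_def finite_sublists)
  have le: "last_gain z \<le> P" if "z \<in> Z" for z
    unfolding P_def using fin that by simp
  have "P \<in> last_gain ` Z" unfolding P_def using fin ne by (intro Max_in) auto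
  then obtain z where z: "z \<in> Z" "last_gain z = P" by auto
  \<comment> \<open>The common target of the long and the short case: at most
    \<open>P * N - P * (3 * P - 1) / 2\<close> closed factors.\<close>
  have final: "6 * card (closed_factors w) \<le> N * (N + 1)"
    if "2 * card (closed_factors w) + 3 * P * P \<le> 2 * P * N + P"
  proof -
    have "int (2 * card (closed_factors w) + 3 * P * P) \<le> int (2 * P * N + P)"
      using that by (simp only: of_nat_le_iff)
    then have "6 * int (card (closed_factors w)) \<le> int N * (int N + 1)"
      by (intro quadratic_bound[of _ "int P"]) simp
    then have "int (6 * card (closed_factors w)) \<le> int (N * (N + 1))"
      by (simp add: algebra_simps)
    then show ?thesis by linarith
  qed
  have ext: "card (closed_factors (ps @ v @ ss)) \<le> card (closed_factors v) + P * (length ps + length ss)"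
    if "ps @ v @ ss = w \<or> ps @ v @ ss = rev w" for ps v ss
  proof (rule card_closed_factors_extend)
    fix z
    show "last_gain z \<le> P" if "sublist z (ps @ v @ ss)"
      using that \<open>ps @ v @ ss = w \<or> ps @ v @ ss = rev w\<close> by (intro le) (auto simp: Z_def)
    have "rev (ps @ v @ ss) = rev w \<or> rev (ps @ v @ ss) = w"
      using that by (metis rev_rev_ident)
    then show "last_gain z \<le> P" if "sublist z (rev (ps @ v @ ss))"
      using that by (intro le) (auto simp: Z_def simp del: rev_append)
  qed
  show ?case
  proof (cases "3 * P < N")
    case True
    \<comment> \<open>At length \<open>3 * P\<close> the induction hypothesis is the target itself;
      each further letter costs at most \<open>P\<close>.\<close>
    have "6 * card (closed_factors (take (3 * P) w)) \<le> 3 * P * (3 * P + 1)"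
      using less[of "take (3 * P) w"] True by (simp add: N_def)
    moreover have "card (closed_factors w) \<le> card (closed_factors (take (3 * P) w)) + P * (N - 3 * P)"
      using ext[of "[]" "take (3 * P) w" "drop (3 * P) w"] by (simp add: N_def)
    moreover have "P * (N - 3 * P) + 3 * P * P = P * N"
      using True by (simp add: diff_mult_distrib2 algebra_simps)
    ultimately show ?thesis unfolding N_def[symmetric]
      by (intro final) (simp add: algebra_simps)
  next
    case short: False
    show ?thesis
    proof (cases "P = 0")
      case True
      then have "card (closed_factors w) = 0"
        using ext[of "[]" "[]" w] by simp
      then show ?thesis by simp
    next
      case False
      have "length z \<le> N"
        using z(1) by (auto simp: Z_def N_def dest: sublist_length_le)
      then have len: "length z \<le> 3 * last_gain z" using short z(2) by simp
      have pos: "0 < last_gain z" using False z(2) by simp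
      have sub: "y \<in> Z" if "sublist y z" for y
        using that z(1) by (auto simp: Z_def intro: sublist_order.order_trans)
      then have "last_gain y \<le> last_gain z" if "sublist y z" for y
        using le that z(2) by simp
      from card_closed_factors_base[OF pos len this, unfolded z(2)]
      obtain v where v: "sublist v z" "2 * P \<le> length v"
        "card (closed_factors v) \<le> (\<Sum>h=P+1..length v. min P (h - P))" .
      \<comment> \<open>\<open>v\<close> may be a factor of the reversal of \<open>w\<close>, which
        has equally many closed factors.\<close>
      obtain ps ss where e: "ps @ v @ ss = w \<or> ps @ v @ ss = rev w"
        using sub[OF v(1)] unfolding Z_def sublist_def by force
      then have "length (ps @ v @ ss) = N" unfolding N_def by (metis length_rev)
      then have "N = length ps + length v + length ss" by simp
      moreover have "card (closed_factors w) \<le> card (closed_factors v) + P * (length ps + length ss)"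
        using ext[OF e] e card_closed_factors_rev[of w] by metis
      ultimately show ?thesis unfolding N_def[symmetric]
        using sum_min[OF v(2)] v(3) by (intro final) (simp add: algebra_simps)
    qed
  qed
qed

lemma Cl_le: "Cl w \<le> 1 + length w + card (closed_factors w)"
proof -
  have "{v. closed_word v \<and> sublist v w} \<subseteq> insert [] ((\<lambda>x. [x]) ` set w) \<union> closed_factors w"
  proof
    fix v assume v: "v \<in> {v. closed_word v \<and> sublist v w}"
    then have "set v \<subseteq> set w" by (auto dest: set_mono_sublist)
    then show "v \<in> insert [] ((\<lambda>x. [x]) ` set w) \<union> closed_factors w"
      using v by (cases v rule: list.exhaust; cases "tl v") (auto simp: closed_factors_def Suc_le_eq)
  qed
  then have "Cl w \<le> card (insert [] ((\<lambda>x. [x]) ` set w) \<union> closed_factors w)"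
    unfolding Cl_def by (rule card_mono[rotated]) (simp add: finite_closed_factors2)
  also have "\<dots> \<le> card (insert [] ((\<lambda>x. [x]) ` set w)) + card (closed_factors w)"
    by (rule card_Un_le)
  also have "card (insert [] ((\<lambda>x. [x]) ` set w)) \<le> Suc (card (set w))"
    using card_insert_le_m1[of "Suc (card (set w))"] card_image_le[of "set w" "\<lambda>x. [x]"]
    by (simp add: card_insert_if le_SucI)
  also have "card (set w) \<le> length w" by (rule card_length)
  finally show ?thesis by simp
qed

theorem theorem3:
  fixes A :: "'a set" and w :: "'a list" and n :: nat
  assumes "finite A" and "w \<in> lists A" and "length w = n"
  shows "real (Cl w) \<le> 1 / 6 * real n ^ 2 + 7 / 6 * real n + 1"
proof -
  have "6 * Cl w \<le> 6 + 6 * n + n * (n + 1)"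
    using Cl_le[of w] card_closed_factors_bound[of w] unfolding assms(3) by linarith
  then have "real (6 * Cl w) \<le> real (6 + 6 * n + n * (n + 1))"
    by (simp only: of_nat_le_iff)
  then show ?thesis
    by (simp add: power2_eq_square algebra_simps)
qed

end
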